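(* For each $n$ let $T_n$ be a random partition of $[n]$, let $p_n,q_n\in[0,1]$, and let $G_n\sim\mathrm{PPM}(T_n,p_n,q_n)$. Assume that $n^2\,\mathbb{E}[S_n^2]\,q_n^3p_n^2=o(1)$ and $q_n=o(n^{-4/5})$ as $n\to\infty$. Then the partition $C_n=\mathcal{D}(G_n)$ returned by Diamond Percolation satisfies $\mathbb{P}(C_n\preceq T_n)\to1$ as $n\to\infty$.
   Context: $[n]=\{1,\dots,n\}$. For a partition $T$ of $[n]$, $i\stackrel{T}{\sim}j$ means $i,j$ are in the same block (community), and $T(i)$ is the block containing $i$. $S_n=|T_n(I_n)|$ where $I_n$ is uniform on $[n]$, independent of $T_n$ (expectations of $S_n$ are over both $T_n$ and $I_n$). For partitions $C,T$ of $[n]$, $C\preceq T$ ($C$ is a refinement of $T$) means that $i\stackrel{C}{\sim}j$ implies $i\stackrel{T}{\sim}j$ for all $i,j\in[n]$. Planted partition model: $G_n\sim\mathrm{PPM}(T_n,p_n,q_n)$ is the random simple undirected graph on $[n]$ in which, conditionally on $T_n$, each pair $ij$ is an edge independently with probability $p_n$ if $i\stackrel{T_n}{\sim}j$ and $q_n$ otherwise. Diamond Percolation $\mathcal{D}$: given a graph $G$ on $[n]$, let $G^*$ be the graph on $[n]$ whose edges are those edges $ij$ of $G$ such that $i$ and $j$ have at least two common neighbors in $G$. The output $\mathcal{D}(G)$ is the partition of $[n]$ into connected components of $G^*$. *)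

theory Defs
  imports "HOL-Probability.Probability" "HOL-Library.Disjoint_Sets" "HOL-Library.Landau_Symbols"
begin

definition same_block :: "nat set set \<Rightarrow> nat \<Rightarrow> nat \<Rightarrow> bool" where
  "same_block T i j \<longleftrightarrow> (\<exists>B\<in>T. i \<in> B \<and> j \<in> B)"

definition block_of :: "nat set set \<Rightarrow> nat \<Rightarrow> nat set" where
  "block_of T i = (THE B. B \<in> T \<and> i \<in> B)"

definition refinement_on :: "nat set \<Rightarrow> nat set set \<Rightarrow> nat set set \<Rightarrow> bool" where
  "refinement_on V C T \<longleftrightarrow> (\<forall>i\<in>V. \<forall>j\<in>V. same_block C i j \<longrightarrow> same_block T i j)"

text \<open>A simple undirected graph on a vertex set \<open>V\<close> is represented by its set of edges,
  a subset of \<open>vertex_pairs V\<close>.\<close>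

definition vertex_pairs :: "nat set \<Rightarrow> nat set set" where
  "vertex_pairs V = {e. e \<subseteq> V \<and> card e = 2}"

text \<open>The conditional law of the planted partition graph on \<open>{1..n}\<close>, given the partition \<open>T\<close>.\<close>

definition ppm :: "nat \<Rightarrow> nat set set \<Rightarrow> real \<Rightarrow> real \<Rightarrow> nat set set pmf" where
  "ppm n T p q =
     map_pmf (\<lambda>f. {e \<in> vertex_pairs {1..n}. f e})
       (Pi_pmf (vertex_pairs {1..n}) False
         (\<lambda>e. bernoulli_pmf (if \<exists>i j. e = {i, j} \<and> same_block T i j then p else q)))"

text \<open>The joint law of the random partition (with law \<open>\<T>\<close>) and the planted partition graph.\<close>

definition planted_partition_model ::
    "nat \<Rightarrow> nat set set pmf \<Rightarrow> real \<Rightarrow> real \<Rightarrow> (nat set set \<times> nat set set) pmf" where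
  "planted_partition_model n \<T> p q =
     bind_pmf \<T> (\<lambda>T. map_pmf (\<lambda>G. (T, G)) (ppm n T p q))"

text \<open>The law of the size of the community of a uniformly random vertex that is independent of the
  random partition. It is only meaningful for \<open>n \<ge> 1\<close>.\<close>

definition community_size :: "nat \<Rightarrow> nat set set pmf \<Rightarrow> nat pmf" where
  "community_size n \<T> =
     map_pmf (\<lambda>(T, i). card (block_of T i)) (pair_pmf \<T> (pmf_of_set {1..n}))"

definition common_neighbors :: "nat set \<Rightarrow> nat set set \<Rightarrow> nat \<Rightarrow> nat \<Rightarrow> nat set" where
  "common_neighbors V G i j = {k \<in> V. {i, k} \<in> G \<and> {j, k} \<in> G}"

definition diamond_graph :: "nat set \<Rightarrow> nat set set \<Rightarrow> nat set set" where
  "diamond_graph V G =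
     {e \<in> G. \<exists>i j. e = {i, j} \<and> card (common_neighbors V G i j) \<ge> 2}"

definition connected_components :: "nat set \<Rightarrow> nat set set \<Rightarrow> nat set set" where
  "connected_components V E =
     V // {(i, j). i \<in> V \<and> j \<in> V \<and> (i, j) \<in> {(u, v). {u, v} \<in> E}\<^sup>*}"

definition diamond_percolation :: "nat set \<Rightarrow> nat set set \<Rightarrow> nat set set" where
  "diamond_percolation V G = connected_components V (diamond_graph V G)"

end

theory Submission
  imports Defs
begin

text \<open>
  If the output of Diamond Percolation is not a refinement of the planted partition, then some
  edge \<open>{i, j}\<close> of the diamond graph joins two different communities: a connected component that
  only used edges within communities would stay inside one community. Together with two common
  neighbours \<open>k\<close> and \<open>l\<close> this edge forms a diamond, that is, five edges of the random graph. The
  proof bounds the expected number of such diamonds.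

  Fix the partition, let \<open>i\<close> and \<open>j\<close> lie in different communities of sizes \<open>s\<^sub>i\<close> and \<open>s\<^sub>j\<close>, and let
  \<open>w k\<close> be the probability that \<open>k\<close> is adjacent to both. As \<open>k\<close> belongs to at most one of the two
  communities, \<open>w k\<close> is at most \<open>q\<^sup>2 + p * q * ([k ~ i] + [k ~ j])\<close>. The five edges are
  independent, so the diamond has probability \<open>q * w k * w l\<close>, and the sum of this over \<open>k\<close> and
  \<open>l\<close>, once the coinciding indices are admitted as well, is \<open>q\<close> times a square, bounded by
  \<open>q * (n * q\<^sup>2 + p * q * (s\<^sub>i + s\<^sub>j))\<^sup>2 \<le> 3 * q * (n\<^sup>2 * q^4 + p\<^sup>2 * q\<^sup>2 * (s\<^sub>i\<^sup>2 + s\<^sub>j\<^sup>2))\<close>.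
  Bounding the square by the sum of squares disposes of all mixed cases (one common neighbour
  inside the two communities and one outside, or one in each community) at once. Summing over
  \<open>i\<close> and \<open>j\<close> and averaging over the partition gives the bound
  \<open>3 * n^4 * q^5 + 6 * n\<^sup>2 * E[S\<^sup>2] * q^3 * p\<^sup>2\<close> of lemma
  \<open>prob_not_refinement_le\<close>. The first term vanishes because \<open>q = o(n powr (- 4/5))\<close>, and the second
  is the quantity assumed to vanish.
\<close>

section \<open>Communities and connected components\<close>

lemma same_block_sym: "same_block T i j \<longleftrightarrow> same_block T j i"
  by (auto simp: same_block_def)

lemma same_block_trans:
  assumes "partition_on V T" "same_block T i j" "same_block T j k"
  shows "same_block T i k"
  using assms unfolding same_block_def partition_on_def disjoint_def by blast

lemma same_block_refl:
  assumes "partition_on V T" "i \<in> V"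
  shows "same_block T i i"
  using assms unfolding same_block_def partition_on_def by blast

lemma block_of_eq:
  assumes "partition_on V T" "i \<in> V"
  shows "block_of T i = {k \<in> V. same_block T i k}"
proof -
  obtain B where B: "B \<in> T" "i \<in> B"
    using assms unfolding partition_on_def by blast
  have uniq: "B' = B" if "B' \<in> T" "i \<in> B'" for B'
    using assms(1) B that unfolding partition_on_def disjoint_def by blast
  have "block_of T i = B"
    unfolding block_of_def by (rule the_equality) (use B uniq in \<open>blast+\<close>)
  moreover have "B \<subseteq> V"
    using assms(1) B unfolding partition_on_def by blast
  moreover have "same_block T i k \<longleftrightarrow> k \<in> B" for k
    unfolding same_block_def using B uniq by metis
  ultimately show ?thesis
    by auto
qed

lemma refinement_connected_components:
  assumes T: "partition_on V T"
    and E: "\<And>u v. {u, v} \<in> E \<Longrightarrow> same_block T u v"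
  shows "refinement_on V (connected_components V E) T"
proof -
  have reach: "same_block T u v" if "(u, v) \<in> {(u, v). {u, v} \<in> E}\<^sup>*" "u \<in> V" for u v
    using that
  proof (induction rule: rtrancl_induct)
    case base
    then show ?case
      using T same_block_refl by blast
  next
    case (step v w)
    then show ?case
      using E same_block_trans[OF T] by blast
  qed
  show ?thesis
    unfolding refinement_on_def
  proof (intro ballI impI)
    fix i j
    assume "same_block (connected_components V E) i j"
    then obtain r where "r \<in> V"
      "(r, i) \<in> {(u, v). {u, v} \<in> E}\<^sup>*" "(r, j) \<in> {(u, v). {u, v} \<in> E}\<^sup>*"
      unfolding same_block_def connected_components_def quotient_def by auto
    then have "same_block T r i" "same_block T r j"
      by (auto intro: reach)
    then show "same_block T i j"
      using same_block_trans[OF T] same_block_sym by blast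
  qed
qed

text \<open>
  The five listed edges determine the event that the union bound is taken over. Distinctness is what
  makes them five different, hence independent, pairs: adjacent vertices differ because a graph has
  no loops, and the two common neighbours differ by choice.
\<close>

lemma bad_diamond:
  assumes T: "partition_on V T" and G: "G \<subseteq> vertex_pairs V"
    and bad: "\<not> refinement_on V (diamond_percolation V G) T"
  shows "\<exists>i\<in>V. \<exists>j\<in>V. \<exists>k\<in>V. \<exists>l\<in>V. distinct [i, j, k, l] \<and> \<not> same_block T i j \<and>
           {{i, j}, {i, k}, {j, k}, {i, l}, {j, l}} \<subseteq> G"
proof -
  obtain u v where uv: "{u, v} \<in> diamond_graph V G" "\<not> same_block T u v"
    using refinement_connected_components[OF T] bad unfolding diamond_percolation_def by blast
  then obtain i j where ij: "{u, v} = {i, j}" "{i, j} \<in> G"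
    "card (common_neighbors V G i j) \<ge> 2"
    unfolding diamond_graph_def by auto
  obtain k l where kl: "k \<in> common_neighbors V G i j" "l \<in> common_neighbors V G i j" "k \<noteq> l"
    using obtain_subset_with_card_n[OF ij(3)] unfolding card_2_iff by (metis insert_subset)
  have pair: "x \<in> V \<and> y \<in> V \<and> x \<noteq> y" if "{x, y} \<in> G" for x y
    using G that unfolding vertex_pairs_def by (cases "x = y") auto
  have "\<not> same_block T i j"
    using uv(2) ij(1) same_block_sym by (metis doubleton_eq_iff)
  moreover have "{{i, j}, {i, k}, {j, k}, {i, l}, {j, l}} \<subseteq> G"
    using ij kl unfolding common_neighbors_def by auto
  moreover from this have "i \<in> V" "j \<in> V" "k \<in> V" "l \<in> V" "distinct [i, j, k, l]"
    using pair[of i j] pair[of i k] pair[of j k] pair[of i l] pair[of j l] kl(3) by auto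
  ultimately show ?thesis
    by blast
qed

section \<open>The expected number of bad diamonds for a fixed partition\<close>

lemma finite_vertex_pairs [simp]: "finite V \<Longrightarrow> finite (vertex_pairs V)"
  by (simp add: vertex_pairs_def)

lemma set_pmf_ppm: "set_pmf (ppm n T p q) \<subseteq> Pow (vertex_pairs {1..n})"
  by (auto simp: ppm_def)

text \<open>
  The independence of the edges enters the argument only through this product formula. The event
  constrains the coordinates in \<open>S\<close> and leaves all others free, so it is a product event.
\<close>

lemma prob_ppm_contains:
  assumes S: "S \<subseteq> vertex_pairs {1..n}" and pq: "p \<in> {0..1}" "q \<in> {0..1}"
  shows "measure_pmf.prob (ppm n T p q) {G. S \<subseteq> G} =
    (\<Prod>e\<in>S. if \<exists>i j. e = {i, j} \<and> same_block T i j then p else q)"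
proof -
  let ?A = "vertex_pairs {1..n}"
  let ?r = "\<lambda>e. if \<exists>i j. e = {i, j} \<and> same_block T i j then p else q"
  let ?B = "\<lambda>e. if e \<in> S then {True} else UNIV"
  have ev: "{f. S \<subseteq> {e \<in> ?A. f e}} = Pi ?A ?B"
    using S by (auto simp: Pi_def)
  have "measure_pmf.prob (ppm n T p q) {G. S \<subseteq> G} =
      measure_pmf.prob (Pi_pmf ?A False (\<lambda>e. bernoulli_pmf (?r e))) (Pi ?A ?B)"
    unfolding ppm_def measure_map_pmf vimage_def mem_Collect_eq ev ..
  also have "\<dots> = (\<Prod>e\<in>?A. measure_pmf.prob (bernoulli_pmf (?r e)) (?B e))"
    by (rule measure_Pi_pmf_Pi) simp
  also have "\<dots> = (\<Prod>e\<in>S. measure_pmf.prob (bernoulli_pmf (?r e)) (?B e))"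
    using S by (intro prod.mono_neutral_right) auto
  also have "\<dots> = (\<Prod>e\<in>S. ?r e)"
    using pq by (intro prod.cong) (auto simp: measure_pmf_single)
  finally show ?thesis .
qed

lemma edge_in_block_iff:
  "(\<exists>a b. {i, j} = {a, b} \<and> same_block T a b) \<longleftrightarrow> same_block T i j"
  by (metis doubleton_eq_iff same_block_sym)

text \<open>
  The bound \<open>w m\<close> for the probability that \<open>m\<close> is a common neighbour replaces the case distinction
  on the community of \<open>m\<close> by a sum of indicators, which is easy to sum over \<open>m\<close>.
\<close>

lemma prob_bad_diamond_le:
  assumes T: "partition_on {1..n} T" and pq: "p \<in> {0..1}" "q \<in> {0..1}"
    and mem: "i \<in> {1..n}" "j \<in> {1..n}" "k \<in> {1..n}" "l \<in> {1..n}"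
    and dist: "distinct [i, j, k, l]" and ij: "\<not> same_block T i j"
  defines "w \<equiv> \<lambda>m. q\<^sup>2 + p * q * (of_bool (same_block T i m) + of_bool (same_block T j m))"
  shows "measure_pmf.prob (ppm n T p q) {G. {{i, j}, {i, k}, {j, k}, {i, l}, {j, l}} \<subseteq> G}
    \<le> q * (w k * w l)"
proof -
  let ?r = "\<lambda>a b. if same_block T a b then p else q"
  define r where "r = (\<lambda>e. if \<exists>a b. e = {a, b} \<and> same_block T a b then p else q)"
  have r: "r {a, b} = ?r a b" for a b
    by (simp add: r_def edge_in_block_iff)
  have w: "?r i m * ?r j m \<le> w m" for m
  proof -
    \<comment> \<open>Both edges at \<open>m\<close> lying within communities would put \<open>i\<close> and \<open>j\<close> into the same one.\<close>
    have "\<not> (same_block T i m \<and> same_block T j m)"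
      using ij same_block_trans[OF T] same_block_sym by blast
    then show ?thesis
      using pq by (auto simp: w_def power2_eq_square mult.commute)
  qed
  have sub: "{{i, j}, {i, k}, {j, k}, {i, l}, {j, l}} \<subseteq> vertex_pairs {1..n}"
    using mem dist by (auto simp: vertex_pairs_def)
  have "measure_pmf.prob (ppm n T p q) {G. {{i, j}, {i, k}, {j, k}, {i, l}, {j, l}} \<subseteq> G}
      = (\<Prod>e\<in>{{i, j}, {i, k}, {j, k}, {i, l}, {j, l}}. r e)"
    unfolding prob_ppm_contains[OF sub pq] r_def ..
  also have "\<dots> = r {i, j} * (r {i, k} * (r {j, k} * (r {i, l} * r {j, l})))"
    using dist by (simp add: doubleton_eq_iff)
  also have "\<dots> = q * ((?r i k * ?r j k) * (?r i l * ?r j l))"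
    using ij by (simp add: r)
  also have "\<dots> \<le> q * (w k * w l)"
    using pq by (intro mult_left_mono mult_mono w) (auto simp: w_def)
  finally show ?thesis .
qed

lemma card_block_of_eq_sum:
  assumes "partition_on {1..n} T" "i \<in> {1..n}"
  shows "real (card (block_of T i)) = (\<Sum>k=1..n. of_bool (same_block T i k))"
proof -
  have "{k \<in> {1..n}. same_block T i k} = {1..n} \<inter> {k. same_block T i k}"
    by blast
  then show ?thesis
    unfolding block_of_eq[OF assms] by simp
qed

lemma square_sum3_le: "(a + b + c)\<^sup>2 \<le> 3 * (a\<^sup>2 + b\<^sup>2 + c\<^sup>2)" for a b c :: real
proof -
  have "3 * (a\<^sup>2 + b\<^sup>2 + c\<^sup>2) - (a + b + c)\<^sup>2 = (a - b)\<^sup>2 + (b - c)\<^sup>2 + (a - c)\<^sup>2"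
    by (simp add: power2_eq_square algebra_simps)
  then show ?thesis
    using zero_le_power2[of "a - b"] zero_le_power2[of "b - c"] zero_le_power2[of "a - c"]
    by linarith
qed

text \<open>
  A union bound over all quadruples \<open>(i, j, k, l)\<close> that may form a bad diamond. Only an upper bound
  is wanted, so the sum may be extended from \<open>Q\<close> to all quadruples, where it factorizes.
\<close>

lemma prob_ppm_not_refinement_le:
  assumes T: "partition_on {1..n} T" and pq: "p \<in> {0..1}" "q \<in> {0..1}"
  shows "measure_pmf.prob (ppm n T p q)
      {G. \<not> refinement_on {1..n} (diamond_percolation {1..n} G) T}
    \<le> 3 * real n ^ 4 * q ^ 5 +
       6 * real n * p\<^sup>2 * q ^ 3 * (\<Sum>i=1..n. (real (card (block_of T i)))\<^sup>2)"
proof -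
  let ?V = "{1..n}"
  define w where "w = (\<lambda>i j m. q\<^sup>2 + p * q * (of_bool (same_block T i m) + of_bool (same_block T j m)))"
  define s where "s = (\<lambda>i. real (card (block_of T i)))"
  define D where "D = (\<lambda>(i, j, k, l). {G :: nat set set. {{i, j}, {i, k}, {j, k}, {i, l}, {j, l}} \<subseteq> G})"
  define Q where "Q = {(i, j, k, l). (i, j, k, l) \<in> ?V \<times> ?V \<times> ?V \<times> ?V \<and>
    distinct [i, j, k, l] \<and> \<not> same_block T i j}"
  have QV: "Q \<subseteq> ?V \<times> ?V \<times> ?V \<times> ?V"
    by (auto simp: Q_def)
  then have finQ: "finite Q"
    by (rule finite_subset) simp
  have w_nonneg: "0 \<le> w i j m" for i j m
    using pq by (simp add: w_def)
  have sum_w: "(\<Sum>m=1..n. w i j m) = real n * q\<^sup>2 + p * q * s i + p * q * s j"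
    if "i \<in> ?V" "j \<in> ?V" for i j
    unfolding w_def s_def card_block_of_eq_sum[OF T that(1)] card_block_of_eq_sum[OF T that(2)]
    by (simp add: sum.distrib sum_distrib_left distrib_left)
  let ?M = "ppm n T p q"
  have "measure_pmf.prob ?M {G. \<not> refinement_on ?V (diamond_percolation ?V G) T}
      = measure_pmf.prob ?M
          ({G. \<not> refinement_on ?V (diamond_percolation ?V G) T} \<inter> set_pmf ?M)"
    by (simp add: measure_Int_set_pmf)
  also have "\<dots> \<le> measure_pmf.prob ?M (\<Union>x\<in>Q. D x)"
  proof (rule measure_pmf.finite_measure_mono)
    show "{G. \<not> refinement_on ?V (diamond_percolation ?V G) T} \<inter> set_pmf ?M \<subseteq> (\<Union>x\<in>Q. D x)"
    proof
      fix G
      assume "G \<in> {G. \<not> refinement_on ?V (diamond_percolation ?V G) T} \<inter> set_pmf ?M"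
      then have "\<exists>i\<in>?V. \<exists>j\<in>?V. \<exists>k\<in>?V. \<exists>l\<in>?V. distinct [i, j, k, l] \<and> \<not> same_block T i j \<and>
           {{i, j}, {i, k}, {j, k}, {i, l}, {j, l}} \<subseteq> G"
        using set_pmf_ppm[of n T p q] by (intro bad_diamond[OF T]) blast+
      then obtain i j k l where "(i, j, k, l) \<in> Q" "G \<in> D (i, j, k, l)"
        unfolding Q_def D_def by auto
      then show "G \<in> (\<Union>x\<in>Q. D x)"
        by blast
    qed
  qed simp
  also have "\<dots> \<le> (\<Sum>x\<in>Q. measure_pmf.prob ?M (D x))"
    by (rule measure_pmf.finite_measure_subadditive_finite) (auto intro: finQ)
  also have "\<dots> \<le> (\<Sum>(i, j, k, l)\<in>Q. q * (w i j k * w i j l))"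
  proof (rule sum_mono)
    fix x
    assume "x \<in> Q"
    then obtain i j k l where x: "x = (i, j, k, l)" and ijkl: "i \<in> ?V" "j \<in> ?V" "k \<in> ?V"
      "l \<in> ?V" "distinct [i, j, k, l]" "\<not> same_block T i j"
      unfolding Q_def by blast
    show "measure_pmf.prob ?M (D x) \<le> (case x of (i, j, k, l) \<Rightarrow> q * (w i j k * w i j l))"
      unfolding x prod.case w_def D_def by (rule prob_bad_diamond_le[OF T pq ijkl])
  qed
  also have "\<dots> \<le> (\<Sum>(i, j, k, l)\<in>?V \<times> ?V \<times> ?V \<times> ?V. q * (w i j k * w i j l))"
    using pq w_nonneg by (intro sum_mono2 QV) auto
  also have "\<dots> = (\<Sum>i\<in>?V. \<Sum>j\<in>?V. q * (\<Sum>m\<in>?V. w i j m)\<^sup>2)"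
    by (simp only: power2_eq_square sum_product)
       (simp only: sum_distrib_left sum.cartesian_product, simp only: case_prod_unfold)
  also have "\<dots> = (\<Sum>i\<in>?V. \<Sum>j\<in>?V. q * (real n * q\<^sup>2 + p * q * s i + p * q * s j)\<^sup>2)"
    using sum_w by simp
  also have "\<dots> \<le> (\<Sum>i\<in>?V. \<Sum>j\<in>?V.
      q * (3 * ((real n * q\<^sup>2)\<^sup>2 + (p * q * s i)\<^sup>2 + (p * q * s j)\<^sup>2)))"
    using pq by (intro sum_mono mult_left_mono square_sum3_le) auto
  also have "\<dots> = (\<Sum>i\<in>?V. \<Sum>j\<in>?V. 3 * (real n)\<^sup>2 * q ^ 5
      + 3 * p\<^sup>2 * q ^ 3 * (s i)\<^sup>2 + 3 * p\<^sup>2 * q ^ 3 * (s j)\<^sup>2)"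
    by (intro sum.cong refl) algebra
  also have "\<dots> = 3 * real n ^ 4 * q ^ 5 + 6 * real n * p\<^sup>2 * q ^ 3 * (\<Sum>i=1..n. (s i)\<^sup>2)"
    by (simp add: sum.distrib sum_distrib_left[symmetric]) algebra
  finally show ?thesis
    unfolding s_def .
qed

section \<open>Averaging over the random partition\<close>

lemma expectation_bind_pmf_finite:
  fixes h :: "'b \<Rightarrow> real"
  assumes "finite (set_pmf M)" "\<And>x. x \<in> set_pmf M \<Longrightarrow> finite (set_pmf (N x))"
  shows "measure_pmf.expectation (bind_pmf M N) h =
    measure_pmf.expectation M (\<lambda>x. measure_pmf.expectation (N x) h)"
  using assms
  by (subst pmf_expectation_bind[of "set_pmf M"]) (auto simp: integral_measure_pmf[of "set_pmf M"])

lemma finite_set_pmf_partitions: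
  fixes n :: nat
  assumes "set_pmf \<T> \<subseteq> {T. partition_on {1..n} T}"
  shows "finite (set_pmf \<T>)"
proof (rule finite_subset)
  show "set_pmf \<T> \<subseteq> Pow (Pow {1..n})"
    using assms unfolding partition_on_def by blast
qed simp

text \<open>
  Averaging over the uniform vertex turns the sum of the squared community sizes, which is how the
  conditional bound sees the partition, into the second moment in the hypothesis of the theorem.
\<close>

lemma expectation_community_size_square:
  assumes \<T>: "set_pmf \<T> \<subseteq> {T. partition_on {1..n} T}" and n: "n > 0"
  shows "measure_pmf.expectation (community_size n \<T>) (\<lambda>s. (real s)\<^sup>2) =
    measure_pmf.expectation \<T> (\<lambda>T. (\<Sum>i=1..n. (real (card (block_of T i)))\<^sup>2)) / real n"
proof -
  have "community_size n \<T> =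
      bind_pmf \<T> (\<lambda>T. map_pmf (\<lambda>i. card (block_of T i)) (pmf_of_set {1..n}))"
    unfolding community_size_def pair_pmf_def
    by (simp add: map_bind_pmf map_pmf_def bind_assoc_pmf bind_return_pmf)
  then show ?thesis
    using n finite_set_pmf_partitions[OF \<T>]
    by (simp add: expectation_bind_pmf_finite integral_pmf_of_set)
qed

lemma prob_not_refinement_le:
  assumes \<T>: "set_pmf \<T> \<subseteq> {T. partition_on {1..n} T}" and n: "n > 0"
    and pq: "p \<in> {0..1}" "q \<in> {0..1}"
  shows "measure_pmf.prob (planted_partition_model n \<T> p q)
      (- {(T, G). refinement_on {1..n} (diamond_percolation {1..n} G) T})
    \<le> 3 * (real n ^ 4 * q ^ 5) +
       6 * ((real n)\<^sup>2 * measure_pmf.expectation (community_size n \<T>) (\<lambda>s. (real s)\<^sup>2)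
              * q ^ 3 * p\<^sup>2)"
proof -
  let ?B = "- {(T, G). refinement_on {1..n} (diamond_percolation {1..n} G) T}"
  let ?Z = "\<lambda>T. \<Sum>i=1..n. (real (card (block_of T i)))\<^sup>2"
  note fin = finite_set_pmf_partitions[OF \<T>]
  have fin_ppm: "finite (set_pmf (ppm n T p q))" for T
    by (rule finite_subset[OF set_pmf_ppm]) simp
  have "measure_pmf.prob (planted_partition_model n \<T> p q) ?B =
      measure_pmf.expectation (planted_partition_model n \<T> p q) (indicator ?B)"
    by simp
  also have "\<dots> = measure_pmf.expectation \<T> (\<lambda>T.
      measure_pmf.expectation (map_pmf (\<lambda>G. (T, G)) (ppm n T p q)) (indicator ?B))"
    unfolding planted_partition_model_def
    by (rule expectation_bind_pmf_finite) (auto simp: fin fin_ppm)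
  also have "\<dots> = measure_pmf.expectation \<T> (\<lambda>T. measure_pmf.prob (ppm n T p q)
      {G. \<not> refinement_on {1..n} (diamond_percolation {1..n} G) T})"
    by (simp add: vimage_def del: integral_map_pmf)
  also have "\<dots> \<le> measure_pmf.expectation \<T> (\<lambda>T. 3 * real n ^ 4 * q ^ 5 +
      6 * real n * p\<^sup>2 * q ^ 3 * ?Z T)"
  proof (intro integral_mono_AE integrable_measure_pmf_finite fin)
    show "AE T in measure_pmf \<T>. measure_pmf.prob (ppm n T p q)
        {G. \<not> refinement_on {1..n} (diamond_percolation {1..n} G) T}
      \<le> 3 * real n ^ 4 * q ^ 5 + 6 * real n * p\<^sup>2 * q ^ 3 * ?Z T"
      unfolding AE_measure_pmf_iff using \<T> prob_ppm_not_refinement_le[OF _ pq] by blast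
  qed
  also have "\<dots> = 3 * real n ^ 4 * q ^ 5 +
      6 * real n * p\<^sup>2 * q ^ 3 * measure_pmf.expectation \<T> ?Z"
    by (simp add: integrable_measure_pmf_finite fin)
  also have "measure_pmf.expectation \<T> ?Z =
      real n * measure_pmf.expectation (community_size n \<T>) (\<lambda>s. (real s)\<^sup>2)"
    using n by (simp add: expectation_community_size_square[OF \<T> n])
  finally show ?thesis
    by (simp add: power2_eq_square mult_ac)
qed

section \<open>Consistency of Diamond Percolation\<close>

lemma smallo_powr_imp_tendsto_0:
  assumes "q \<in> o(\<lambda>n. real n powr (- 4 / 5))"
  shows "(\<lambda>n. real n ^ 4 * q n ^ 5) \<longlonglongrightarrow> 0"
proof -
  have "(\<lambda>n. (q n / real n powr (- 4 / 5)) ^ 5) \<longlonglongrightarrow> 0 ^ 5"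
    by (intro tendsto_power smalloD_tendsto assms)
  moreover have "\<forall>\<^sub>F n in sequentially.
      (q n / real n powr (- 4 / 5)) ^ 5 = real n ^ 4 * q n ^ 5"
    using eventually_gt_at_top[of 0]
  proof eventually_elim
    case (elim n)
    have "(real n powr (- 4 / 5)) ^ 5 = real n powr (- 4)"
      using elim by (simp add: powr_power)
    also have "\<dots> = 1 / real n ^ 4"
      using elim by (simp add: powr_minus_divide)
    finally show ?case
      by (simp add: power_divide)
  qed
  ultimately show ?thesis
    using Lim_transform_eventually by fastforce
qed

theorem theorem3p3:
  fixes \<T> :: "nat \<Rightarrow> nat set set pmf" and p q :: "nat \<Rightarrow> real"
  assumes "\<And>n. set_pmf (\<T> n) \<subseteq> {T. partition_on {1..n} T}"
    and "\<And>n. 0 \<le> p n \<and> p n \<le> 1"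
    and "\<And>n. 0 \<le> q n \<and> q n \<le> 1"
    and "(\<lambda>n. (real n)\<^sup>2 * measure_pmf.expectation (community_size n (\<T> n)) (\<lambda>s. (real s)\<^sup>2)
              * q n ^ 3 * (p n)\<^sup>2) \<in> o(\<lambda>_. 1)"
    and "q \<in> o(\<lambda>n. real n powr (- 4 / 5))"
  shows "(\<lambda>n. measure_pmf.prob (planted_partition_model n (\<T> n) (p n) (q n))
            {(T, G). refinement_on {1..n} (diamond_percolation {1..n} G) T}) \<longlonglongrightarrow> 1"
proof -
  let ?M = "\<lambda>n. planted_partition_model n (\<T> n) (p n) (q n)"
  let ?A = "\<lambda>n. {(T, G). refinement_on {1..n} (diamond_percolation {1..n} G) T}"
  let ?b = "\<lambda>n. (real n)\<^sup>2 * measure_pmf.expectation (community_size n (\<T> n)) (\<lambda>s. (real s)\<^sup>2)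
              * q n ^ 3 * (p n)\<^sup>2"
  have b: "?b \<longlonglongrightarrow> 0"
    using smalloD_tendsto[OF assms(4)] by simp
  have lim: "(\<lambda>n. 3 * (real n ^ 4 * q n ^ 5) + 6 * ?b n) \<longlonglongrightarrow> 0"
    using tendsto_add[OF tendsto_mult_left[OF smallo_powr_imp_tendsto_0[OF assms(5)], of 3]
        tendsto_mult_left[OF b, of 6]] by simp
  have "(\<lambda>n. measure_pmf.prob (?M n) (- ?A n)) \<longlonglongrightarrow> 0"
  proof (rule tendsto_sandwich[OF _ _ tendsto_const lim])
    show "\<forall>\<^sub>F n in sequentially.
        measure_pmf.prob (?M n) (- ?A n) \<le> 3 * (real n ^ 4 * q n ^ 5) + 6 * ?b n"
      using eventually_gt_at_top[of 0]
    proof eventually_elim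
      case (elim n)
      then show ?case
        using assms(1-3) by (intro prob_not_refinement_le) auto
    qed
  qed simp
  then have "(\<lambda>n. 1 - measure_pmf.prob (?M n) (- ?A n)) \<longlonglongrightarrow> 1 - 0"
    by (intro tendsto_diff tendsto_const)
  moreover have "1 - measure_pmf.prob (?M n) (- ?A n) = measure_pmf.prob (?M n) (?A n)" for n
    using measure_pmf.prob_compl[of "?A n" "?M n"] by (simp add: Compl_eq_Diff_UNIV)
  ultimately show ?thesis
    by simp
qed

end
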